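(* (i) Let $\mathbf S=(S,\vee,(\odot_x;x\in S),\rightarrow,1)$ be a sectionally residuated join-semilattice and define a partial binary operation $\odot$ on $S$ as follows: if $x,y\in S$ have a common lower bound $z$ then $x\odot y:=x\odot_zy$ (and $x\odot y$ is undefined if $x,y$ have no common lower bound). Then $\odot$ is well-defined (independent of the choice of $z$) and $\mathbb R(\mathbf S):=(S,\vee,\odot,\rightarrow,1)$ is a relatively residuated join-semilattice. (ii) Let $\mathbf R=(R,\vee,\odot,\rightarrow,1)$ be a relatively residuated join-semilattice and for each $x\in R$ let $\odot_x$ be the restriction of $\odot$ to $[x,1]$. Then $\mathbb S(\mathbf R):=(R,\vee,(\odot_x;x\in R),\rightarrow,1)$ is a sectionally residuated join-semilattice.
   Context: In a join-semilattice $(S,\vee,1)$ with top element $1$, the order is $x\leq y$ iff $x\vee y=y$, and $[x,1]:=\{y\in S: x\leq y\}$. A sectionally residuated join-semilattice is a quintuple $(S,\vee,(\odot_x;x\in S),\rightarrow,1)$ such that $(S,\vee,1)$ is a join-semilattice with top element $1$, for each $x\in S$, $([x,1],\odot_x,1)$ is a commutative monoid, $\rightarrow$ is a binary operation on $S$, and for all $x,y,z,u\in S$: (a) if $z\leq u\leq x,y$ then $x\odot_zy=x\odot_uy$; (b) if $u\leq x,y,z$ and $x\leq y$ then $x\odot_uz\leq y\odot_uz$; (c) $(x\vee z)\odot_z(y\vee z)\leq z$ if and only if $x\vee z\leq y\rightarrow z$; (d) $(x\vee y)\rightarrow y=x\rightarrow y$. A relatively residuated join-semilattice is a partial algebra $(R,\vee,\odot,\rightarrow,1)$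 of type $(2,2,2,0)$ where $\vee,\rightarrow$ are (total) binary operations, $x\odot y$ is defined if and only if $x$ and $y$ have a common lower bound, and in this case $z\leq x\odot y$ for all $z\in R$ with $z\leq x,y$, and for all $x,y,z\in R$: (10) $(R,\vee,1)$ is a join-semilattice with top element $1$; (11) $x\odot1=1\odot x=x$; (12) $x\odot y=y\odot x$ whenever $x$ and $y$ have a common lower bound; (13) $(x\odot y)\odot z=x\odot(y\odot z)$ whenever $x,y,z$ have a common lower bound; (14) $x\leq y$ implies $x\odot z\leq y\odot z$ whenever $x$ and $z$ have a common lower bound; (15) $(x\vee z)\odot(y\vee z)\leq z$ if and only if $x\vee z\leq y\rightarrow z$; (16) $(x\vee y)\rightarrow y=x\rightarrow y$. *)

theory Defs
  imports "HOL-Algebra.Group"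
begin

text \<open>
  The universe of every algebra below is the whole type \<open>'a\<close>; the operations are explicit parameters.
\<close>

locale join_semilattice_top = semilattice jn
  for jn :: "'a \<Rightarrow> 'a \<Rightarrow> 'a" (infixl "\<squnion>\<^sub>S" 65) +
  fixes top_elem :: 'a ("\<one>\<^sub>S")
  assumes join_top: "x \<squnion>\<^sub>S \<one>\<^sub>S = \<one>\<^sub>S"

definition join_le :: "('a \<Rightarrow> 'a \<Rightarrow> 'a) \<Rightarrow> 'a \<Rightarrow> 'a \<Rightarrow> bool" where
  "join_le jn x y \<longleftrightarrow> jn x y = y"

text \<open>The section \<open>[x, 1]\<close>.\<close>

definition section_above :: "('a \<Rightarrow> 'a \<Rightarrow> 'a) \<Rightarrow> 'a \<Rightarrow> 'a set" where
  "section_above jn x = {y. join_le jn x y}"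

definition common_lower_bound :: "('a \<Rightarrow> 'a \<Rightarrow> 'a) \<Rightarrow> 'a \<Rightarrow> 'a \<Rightarrow> 'a \<Rightarrow> bool" where
  "common_lower_bound jn z x y \<longleftrightarrow> join_le jn z x \<and> join_le jn z y"

text \<open>
  The operation \<open>\<odot>\<^sub>u\<close> on \<open>[u, 1]\<close> is \<open>smult u\<close>. Only its values on arguments in \<open>[u, 1]\<close>
  are constrained; those outside \<open>[u, 1]\<close> are arbitrary and do not belong to the structure.
\<close>

locale sectionally_residuated_join_semilattice = join_semilattice_top jn top_elem
  for jn :: "'a \<Rightarrow> 'a \<Rightarrow> 'a" (infixl "\<squnion>\<^sub>S" 65)
    and smult :: "'a \<Rightarrow> 'a \<Rightarrow> 'a \<Rightarrow> 'a"
    and imp :: "'a \<Rightarrow> 'a \<Rightarrow> 'a" (infixr "\<rightarrow>\<^sub>S" 60)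
    and top_elem :: 'a ("\<one>\<^sub>S") +
  assumes section_monoid:
      "comm_monoid \<lparr>carrier = section_above jn x, mult = smult x, one = \<one>\<^sub>S\<rparr>"
    and smult_section_indep:
      "\<lbrakk>join_le jn z u; join_le jn u x; join_le jn u y\<rbrakk> \<Longrightarrow> smult z x y = smult u x y"
    and smult_mono:
      "\<lbrakk>join_le jn u x; join_le jn u y; join_le jn u z; join_le jn x y\<rbrakk>
        \<Longrightarrow> join_le jn (smult u x z) (smult u y z)"
    and sectional_adjointness:
      "join_le jn (smult z (x \<squnion>\<^sub>S z) (y \<squnion>\<^sub>S z)) z \<longleftrightarrow> join_le jn (x \<squnion>\<^sub>S z) (y \<rightarrow>\<^sub>S z)"
    and join_imp: "(x \<squnion>\<^sub>S y) \<rightarrow>\<^sub>S y = x \<rightarrow>\<^sub>S y"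

text \<open>
  The partial operation \<open>\<odot>\<close> is option-valued, with \<open>None\<close> meaning undefined. By the first two
  axioms all products occurring under \<open>the\<close> and \<open>Option.bind\<close> below are defined.
\<close>

locale relatively_residuated_join_semilattice = join_semilattice_top jn top_elem
  for jn :: "'a \<Rightarrow> 'a \<Rightarrow> 'a" (infixl "\<squnion>\<^sub>S" 65)
    and pmult :: "'a \<Rightarrow> 'a \<Rightarrow> 'a option" (infixl "\<odot>\<^sub>S" 70)
    and imp :: "'a \<Rightarrow> 'a \<Rightarrow> 'a" (infixr "\<rightarrow>\<^sub>S" 60)
    and top_elem :: 'a ("\<one>\<^sub>S") +
  assumes pmult_defined_iff: "x \<odot>\<^sub>S y \<noteq> None \<longleftrightarrow> (\<exists>z. common_lower_bound jn z x y)"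
    and pmult_lower_bound: "common_lower_bound jn z x y \<Longrightarrow> join_le jn z (the (x \<odot>\<^sub>S y))"
    and pmult_top: "x \<odot>\<^sub>S \<one>\<^sub>S = Some x" "\<one>\<^sub>S \<odot>\<^sub>S x = Some x"
    and pmult_commute: "common_lower_bound jn w x y \<Longrightarrow> x \<odot>\<^sub>S y = y \<odot>\<^sub>S x"
    and pmult_assoc:
      "\<lbrakk>join_le jn w x; join_le jn w y; join_le jn w z\<rbrakk>
        \<Longrightarrow> Option.bind (x \<odot>\<^sub>S y) (\<lambda>p. p \<odot>\<^sub>S z) = Option.bind (y \<odot>\<^sub>S z) (\<lambda>q. x \<odot>\<^sub>S q)"
    and pmult_mono:
      "\<lbrakk>join_le jn x y; common_lower_bound jn w x z\<rbrakk>
        \<Longrightarrow> join_le jn (the (x \<odot>\<^sub>S z)) (the (y \<odot>\<^sub>S z))"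
    and relative_adjointness:
      "join_le jn (the ((x \<squnion>\<^sub>S z) \<odot>\<^sub>S (y \<squnion>\<^sub>S z))) z \<longleftrightarrow> join_le jn (x \<squnion>\<^sub>S z) (y \<rightarrow>\<^sub>S z)"
    and join_imp: "(x \<squnion>\<^sub>S y) \<rightarrow>\<^sub>S y = x \<rightarrow>\<^sub>S y"

text \<open>
  Gluing the operations \<open>\<odot>\<^sub>z\<close> together. The description under \<open>THE\<close> determines a value
  exactly when \<open>x \<odot>\<^sub>z y\<close> does not depend on the common lower bound \<open>z\<close>.
\<close>

definition glued_mult ::
  "('a \<Rightarrow> 'a \<Rightarrow> 'a) \<Rightarrow> ('a \<Rightarrow> 'a \<Rightarrow> 'a \<Rightarrow> 'a) \<Rightarrow> 'a \<Rightarrow> 'a \<Rightarrow> 'a option" where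
  "glued_mult jn smult x y =
    (if \<exists>z. common_lower_bound jn z x y
     then Some (THE p. \<exists>z. common_lower_bound jn z x y \<and> p = smult z x y)
     else None)"

definition section_restrict ::
  "('a \<Rightarrow> 'a \<Rightarrow> 'a) \<Rightarrow> ('a \<Rightarrow> 'a \<Rightarrow> 'a option) \<Rightarrow> 'a \<Rightarrow> 'a \<Rightarrow> 'a \<Rightarrow> 'a" where
  "section_restrict jn pmult u x y =
    (if x \<in> section_above jn u \<and> y \<in> section_above jn u then the (pmult x y) else undefined)"

end

theory Submission
  imports Defs
begin

text \<open>The two structures carry the same information: any two elements with a common lower
  bound lie in a common section, and the section products agree wherever they overlap. For two lower
  bounds \<open>z\<close>, \<open>w\<close> of \<open>x\<close>, \<open>y\<close>, the join of
  \<open>z\<close> and \<open>w\<close> is again a lower bound lying above both, so axiom (a)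
  identifies both products with the one taken there (\<open>smult_well_defined\<close>). Hence the
  glued product can be computed in any section containing both arguments
  (\<open>glued_mult_eq\<close>), and every axiom about it becomes an axiom of one suitable section.
  Conversely, the lower bound axiom of a relatively residuated join-semilattice says that each
  section is closed under the partial product, so restriction gives commutative monoids
  (\<open>comm_monoid_section_restrict\<close>), and they are compatible because all restrict one
  operation.\<close>

context join_semilattice_top
begin

lemma join_le_refl: "join_le jn x x"
  by (simp add: join_le_def)

lemma join_le_trans: "join_le jn x y \<Longrightarrow> join_le jn y z \<Longrightarrow> join_le jn x z"
  unfolding join_le_def by (metis assoc)

lemma join_le_top: "join_le jn x \<one>\<^sub>S"
  by (simp add: join_le_def join_top)

lemma join_le_join1: "join_le jn x (x \<squnion>\<^sub>S y)"
  by (simp add: join_le_def assoc [symmetric])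

lemma join_le_join2: "join_le jn y (x \<squnion>\<^sub>S y)"
  by (metis commute join_le_join1)

lemma join_least: "join_le jn x z \<Longrightarrow> join_le jn y z \<Longrightarrow> join_le jn (x \<squnion>\<^sub>S y) z"
  by (simp add: join_le_def assoc)

end

context sectionally_residuated_join_semilattice
begin

lemma smult_closed:
  assumes "join_le jn u x" "join_le jn u y"
  shows "join_le jn u (smult u x y)"
proof -
  interpret M: comm_monoid "\<lparr>carrier = section_above jn u, mult = smult u, one = \<one>\<^sub>S\<rparr>"
    by (rule section_monoid)
  show ?thesis
    using M.m_closed[of x y] assms by (simp add: section_above_def)
qed

lemma smult_top:
  assumes "join_le jn u x"
  shows "smult u x \<one>\<^sub>S = x"
proof -
  interpret M: comm_monoid "\<lparr>carrier = section_above jn u, mult = smult u, one = \<one>\<^sub>S\<rparr>"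
    by (rule section_monoid)
  show ?thesis
    using M.r_one[of x] assms by (simp add: section_above_def)
qed

lemma smult_commute:
  assumes "join_le jn u x" "join_le jn u y"
  shows "smult u x y = smult u y x"
proof -
  interpret M: comm_monoid "\<lparr>carrier = section_above jn u, mult = smult u, one = \<one>\<^sub>S\<rparr>"
    by (rule section_monoid)
  show ?thesis
    using M.m_comm[of x y] assms by (simp add: section_above_def)
qed

lemma smult_assoc:
  assumes "join_le jn u x" "join_le jn u y" "join_le jn u z"
  shows "smult u (smult u x y) z = smult u x (smult u y z)"
proof -
  interpret M: comm_monoid "\<lparr>carrier = section_above jn u, mult = smult u, one = \<one>\<^sub>S\<rparr>"
    by (rule section_monoid)
  show ?thesis
    using M.m_assoc[of x y z] assms by (simp add: section_above_def)
qed

text \<open>Both products are compared with the one at \<open>z \<squnion>\<^sub>S w\<close>, which is again a common lower bound.\<close>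

lemma smult_well_defined:
  assumes "common_lower_bound jn z x y" "common_lower_bound jn w x y"
  shows "smult z x y = smult w x y"
proof -
  have "join_le jn (z \<squnion>\<^sub>S w) x" "join_le jn (z \<squnion>\<^sub>S w) y"
    using assms by (simp_all add: common_lower_bound_def join_least)
  then show ?thesis
    using smult_section_indep join_le_join1 join_le_join2 by metis
qed

text \<open>All candidates for the \<open>THE\<close> value coincide by
  \<open>smult_well_defined\<close>. Leaving \<open>u\<close> free lets each later step choose the
  section in which to compute.\<close>

lemma glued_mult_eq:
  assumes "join_le jn u x" "join_le jn u y"
  shows "glued_mult jn smult x y = Some (smult u x y)"
proof -
  have u: "common_lower_bound jn u x y"
    using assms by (simp add: common_lower_bound_def)
  then have "(THE p. \<exists>z. common_lower_bound jn z x y \<and> p = smult z x y) = smult u x y"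
    by (intro the_equality) (auto intro: smult_well_defined)
  with u show ?thesis
    by (auto simp: glued_mult_def)
qed

lemma relatively_residuated_glued_mult:
  "relatively_residuated_join_semilattice jn (glued_mult jn smult) imp \<one>\<^sub>S"
proof unfold_locales
  fix x y :: 'a
  show "glued_mult jn smult x y \<noteq> None \<longleftrightarrow> (\<exists>z. common_lower_bound jn z x y)"
    by (simp add: glued_mult_def)
next
  fix x y z :: 'a
  assume "common_lower_bound jn z x y"
  then show "join_le jn z (the (glued_mult jn smult x y))"
    by (simp add: common_lower_bound_def glued_mult_eq[of z] smult_closed)
next
  fix x :: 'a
  show "glued_mult jn smult x \<one>\<^sub>S = Some x"
    \<comment> \<open>The element \<open>x\<close> is itself a lower bound of \<open>x\<close> and
      the top, so the unit law of the section above \<open>x\<close> applies.\<close>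
    by (simp add: glued_mult_eq[of x] join_le_refl join_le_top smult_top)
next
  fix x :: 'a
  show "glued_mult jn smult \<one>\<^sub>S x = Some x"
    by (simp add: glued_mult_eq[of x] join_le_refl join_le_top smult_top smult_commute[of x "\<one>\<^sub>S"])
next
  fix w x y :: 'a
  assume "common_lower_bound jn w x y"
  then show "glued_mult jn smult x y = glued_mult jn smult y x"
    by (simp add: common_lower_bound_def glued_mult_eq[of w] smult_commute)
next
  fix w x y z :: 'a
  assume "join_le jn w x" "join_le jn w y" "join_le jn w z"
  then show "Option.bind (glued_mult jn smult x y) (\<lambda>p. glued_mult jn smult p z)
      = Option.bind (glued_mult jn smult y z) (\<lambda>q. glued_mult jn smult x q)"
    \<comment> \<open>By closure the inner products stay above \<open>w\<close>, so the outer
      products are defined and are computed in the same section.\<close>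
    by (simp add: glued_mult_eq[of w] smult_closed smult_assoc)
next
  fix w x y z :: 'a
  assume "join_le jn x y" "common_lower_bound jn w x z"
  \<comment> \<open>Only \<open>x\<close> and \<open>z\<close> are assumed to lie above
    \<open>w\<close>; monotonicity within the section above \<open>w\<close> needs \<open>y\<close>
    there as well.\<close>
  moreover from this have "join_le jn w y"
    by (auto simp: common_lower_bound_def intro: join_le_trans)
  ultimately show "join_le jn (the (glued_mult jn smult x z)) (the (glued_mult jn smult y z))"
    by (simp add: common_lower_bound_def glued_mult_eq[of w] smult_mono)
next
  fix x y z :: 'a
  show "join_le jn (the (glued_mult jn smult (x \<squnion>\<^sub>S z) (y \<squnion>\<^sub>S z))) z \<longleftrightarrow> join_le jn (x \<squnion>\<^sub>S z) (y \<rightarrow>\<^sub>S z)"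
    \<comment> \<open>Both factors are joins with \<open>z\<close>, so \<open>z\<close> is a common
      lower bound and the sectional adjointness at \<open>z\<close> applies.\<close>
    by (simp add: glued_mult_eq[of z] join_le_join2 sectional_adjointness)
next
  fix x y :: 'a
  show "(x \<squnion>\<^sub>S y) \<rightarrow>\<^sub>S y = x \<rightarrow>\<^sub>S y"
    by (rule join_imp)
qed

end

context relatively_residuated_join_semilattice
begin

lemma section_restrict_eq:
  "join_le jn u x \<Longrightarrow> join_le jn u y \<Longrightarrow> section_restrict jn pmult u x y = the (x \<odot>\<^sub>S y)"
  by (simp add: section_restrict_def section_above_def)

lemma pmult_closed:
  "join_le jn u x \<Longrightarrow> join_le jn u y \<Longrightarrow> join_le jn u (the (x \<odot>\<^sub>S y))"
  by (simp add: pmult_lower_bound common_lower_bound_def)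

lemma pmult_Some:
  "join_le jn u x \<Longrightarrow> join_le jn u y \<Longrightarrow> x \<odot>\<^sub>S y = Some (the (x \<odot>\<^sub>S y))"
  using pmult_defined_iff[of x y] by (auto simp: common_lower_bound_def)

text \<open>The common lower bound \<open>u\<close> makes both inner products defined, so the two
  \<open>Option.bind\<close> terms in \<open>pmult_assoc\<close> reduce to their
  continuations.\<close>

lemma the_pmult_assoc:
  assumes "join_le jn u x" "join_le jn u y" "join_le jn u z"
  shows "the (the (x \<odot>\<^sub>S y) \<odot>\<^sub>S z) = the (x \<odot>\<^sub>S the (y \<odot>\<^sub>S z))"
  using pmult_assoc[OF assms] pmult_Some[OF assms(1,2)] pmult_Some[OF assms(2,3)]
  by (metis Option.bind.bind_lunit)

text \<open>Closure is \<open>pmult_lower_bound\<close> applied to \<open>u\<close> itself; the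
  monoid laws are inherited because \<open>u\<close> bounds all elements of its section from
  below.\<close>

lemma comm_monoid_section_restrict:
  "comm_monoid \<lparr>carrier = section_above jn u, mult = section_restrict jn pmult u, one = \<one>\<^sub>S\<rparr>"
proof (rule comm_monoidI)
  fix x y
  assume "x \<in> carrier \<lparr>carrier = section_above jn u, mult = section_restrict jn pmult u, one = \<one>\<^sub>S\<rparr>"
    "y \<in> carrier \<lparr>carrier = section_above jn u, mult = section_restrict jn pmult u, one = \<one>\<^sub>S\<rparr>"
  then show "mult \<lparr>carrier = section_above jn u, mult = section_restrict jn pmult u, one = \<one>\<^sub>S\<rparr> x y
      = mult \<lparr>carrier = section_above jn u, mult = section_restrict jn pmult u, one = \<one>\<^sub>S\<rparr> y x"
    using pmult_commute[of u x y]
    by (simp add: section_above_def common_lower_bound_def section_restrict_eq)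
qed (simp_all add: section_above_def section_restrict_eq pmult_closed join_le_top pmult_top
    the_pmult_assoc)

lemma sectionally_residuated_section_restrict:
  "sectionally_residuated_join_semilattice jn (section_restrict jn pmult) imp \<one>\<^sub>S"
proof (intro sectionally_residuated_join_semilattice.intro
    sectionally_residuated_join_semilattice_axioms.intro)
  show "join_semilattice_top jn \<one>\<^sub>S"
    by (rule join_semilattice_top_axioms)
next
  fix u
  show "comm_monoid \<lparr>carrier = section_above jn u, mult = section_restrict jn pmult u, one = \<one>\<^sub>S\<rparr>"
    by (rule comm_monoid_section_restrict)
next
  fix x y z u
  assume "join_le jn z u" "join_le jn u x" "join_le jn u y"
  moreover from this have "join_le jn z x" "join_le jn z y"
    by (blast intro: join_le_trans)+
  \<comment> \<open>Both sides unfold to the value of the same partial product of \<open>x\<close>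
    and \<open>y\<close>.\<close>
  ultimately show "section_restrict jn pmult z x y = section_restrict jn pmult u x y"
    by (simp add: section_restrict_eq)
next
  fix x y z u
  assume "join_le jn u x" "join_le jn u y" "join_le jn u z" "join_le jn x y"
  then show "join_le jn (section_restrict jn pmult u x z) (section_restrict jn pmult u y z)"
    using pmult_mono[of x y u z] by (simp add: section_restrict_eq common_lower_bound_def)
next
  fix x y z
  show "join_le jn (section_restrict jn pmult z (x \<squnion>\<^sub>S z) (y \<squnion>\<^sub>S z)) z
      \<longleftrightarrow> join_le jn (x \<squnion>\<^sub>S z) (y \<rightarrow>\<^sub>S z)"
    by (simp add: section_restrict_eq join_le_join2 relative_adjointness)
next
  fix x y
  show "(x \<squnion>\<^sub>S y) \<rightarrow>\<^sub>S y = x \<rightarrow>\<^sub>S y"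
    by (rule join_imp)
qed

end

theorem theorem4p5:
  shows "(\<forall>(jn :: 'a \<Rightarrow> 'a \<Rightarrow> 'a) smult imp top_elem.
      sectionally_residuated_join_semilattice jn smult imp top_elem \<longrightarrow>
        (\<forall>x y z w. common_lower_bound jn z x y \<and> common_lower_bound jn w x y
            \<longrightarrow> smult z x y = smult w x y) \<and>
        relatively_residuated_join_semilattice jn (glued_mult jn smult) imp top_elem) \<and>
    (\<forall>(jn :: 'a \<Rightarrow> 'a \<Rightarrow> 'a) pmult imp top_elem.
      relatively_residuated_join_semilattice jn pmult imp top_elem \<longrightarrow>
        sectionally_residuated_join_semilattice jn (section_restrict jn pmult) imp top_elem)"
  by (blast intro: sectionally_residuated_join_semilattice.smult_well_defined
      sectionally_residuated_join_semilattice.relatively_residuated_glued_mult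
      relatively_residuated_join_semilattice.sectionally_residuated_section_restrict)

end
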